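(* a) Let $\Omega:\mathbb R\to\mathbb R$ be the Vershik-Kerov-Logan-Shepp curve, $$\Omega(x)=\begin{cases}\dfrac{2}{\pi}\left(x\arcsin\left(\dfrac{x}{2}\right)+\sqrt{4-x^2}\right), & |x|\le 2,\\[2mm] |x|, & |x|\ge 2.\end{cases}$$ Then the semicircle law, i.e. the probability measure on $[-2,2]$ with density $\frac{1}{2\pi}\sqrt{4-x^2}$, is the transition measure of the continual Young diagram $\Omega$. b) Let $\alpha\ge1$. Let $\Omega_\alpha:\mathbb R\to\mathbb R$ be the unique continuous function such that $$\Omega_\alpha''(x)=\frac{x+(\alpha-1)}{\pi x\sqrt{4\alpha-(x-(\alpha+1))^2}},\qquad x\in\big((\alpha+1)-2\sqrt\alpha,\ (\alpha+1)+2\sqrt\alpha\big),$$ and $\Omega_\alpha(x)=|x-\alpha|$ for $x\in(-\infty,(\alpha+1)-2\sqrt\alpha]\cup[(\alpha+1)+2\sqrt\alpha,\infty)$. Then the Marchenko-Pastur distribution with parameter $\alpha$, i.e. the probability measure on $[(\alpha+1)-2\sqrt\alpha,(\alpha+1)+2\sqrt\alpha]$ with density $$\frac{\sqrt{4\alpha-(x-(\alpha+1))^2}}{2\pi x},$$ is the transition measure of the continual Young diagram $\Omega_\alpha$.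
   Context: A continual Young diagram is a function $w:\mathbb R\to\mathbb R$ such that $|w(x_1)-w(x_2)|\le|x_1-x_2|$ for all $x_1,x_2\in\mathbb R$, and there is a point $x_0\in\mathbb R$ (the center) with $w(x)=|x-x_0|$ when $|x|$ is large enough. For such $w$ put $\sigma(x)=\frac12(w(x)-|x|)$; $\sigma'$ exists almost everywhere and is compactly supported. For $k\in\mathbb N=\{1,2,\dots\}$ define $$\tilde p_k(w)=-k\int_{-\infty}^{\infty}x^{k-1}\sigma'(x)\,dx=\int_{-\infty}^\infty x^k\sigma''(x)\,dx,$$ where $\sigma''$ is understood in the sense of distributions. The transition measure of $w$ is the compactly supported probability measure $\mu$ on $\mathbb R$, with moments $\mu_k=\int x^k\,d\mu$, characterized by the identity of formal power series $$1+\sum_{k=1}^\infty\mu_kz^k=\exp\left(\sum_{k=1}^\infty\frac{\tilde p_k(w)}{k}z^k\right).$$ *)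

theory Defs
  imports "HOL-Probability.Probability" "HOL-Computational_Algebra.Formal_Power_Series"
begin

definition continual_young_diagram :: "(real \<Rightarrow> real) \<Rightarrow> bool" where
  "continual_young_diagram w \<longleftrightarrow>
     (\<forall>x1 x2. \<bar>w x1 - w x2\<bar> \<le> \<bar>x1 - x2\<bar>) \<and>
     (\<exists>x0 R. \<forall>x. \<bar>x\<bar> \<ge> R \<longrightarrow> w x = \<bar>x - x0\<bar>)"

definition charge :: "(real \<Rightarrow> real) \<Rightarrow> real \<Rightarrow> real" where
  "charge w x = (w x - \<bar>x\<bar>) / 2"

(* The derivative of charge w exists only almost everywhere; on the exceptional null set deriv
   returns an unspecified value, which the Lebesgue integral does not see. *)
definition ptilde :: "nat \<Rightarrow> (real \<Rightarrow> real) \<Rightarrow> real" where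
  "ptilde k w = - real k * (LINT x|lebesgue. x ^ (k - 1) * deriv (charge w) x)"

definition moment :: "real measure \<Rightarrow> nat \<Rightarrow> real" where
  "moment \<mu> k = (LINT x|\<mu>. x ^ k)"

(* fps_compose (fps_exp 1) A is exp(A); A has zero constant term here, so the
   composition is the usual one. *)
definition is_transition_measure :: "real measure \<Rightarrow> (real \<Rightarrow> real) \<Rightarrow> bool" where
  "is_transition_measure \<mu> w \<longleftrightarrow>
     prob_space \<mu> \<and> sets \<mu> = sets borel \<and>
     (\<exists>K. compact K \<and> (AE x in \<mu>. x \<in> K)) \<and>
     1 + Abs_fps (\<lambda>k. if k = 0 then 0 else moment \<mu> k) =
       fps_compose (fps_exp 1) (Abs_fps (\<lambda>k. if k = 0 then 0 else ptilde k w / real k))"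

definition vkls_curve :: "real \<Rightarrow> real" where
  "vkls_curve x =
     (if \<bar>x\<bar> \<le> 2 then 2 / pi * (x * arcsin (x / 2) + sqrt (4 - x\<^sup>2)) else \<bar>x\<bar>)"

definition semicircle_law :: "real measure" where
  "semicircle_law =
     density lborel (\<lambda>x. ennreal (indicator {-2..2} x * (1 / (2 * pi) * sqrt (4 - x\<^sup>2))))"

definition mp_left :: "real \<Rightarrow> real" where
  "mp_left \<alpha> = (\<alpha> + 1) - 2 * sqrt \<alpha>"

definition mp_right :: "real \<Rightarrow> real" where
  "mp_right \<alpha> = (\<alpha> + 1) + 2 * sqrt \<alpha>"

(* The defining conditions of the curve Omega_alpha; that exactly one function satisfies them
   is a claim to be proved, not part of the definition. *)
definition is_mp_curve :: "real \<Rightarrow> (real \<Rightarrow> real) \<Rightarrow> bool" where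
  "is_mp_curve \<alpha> w \<longleftrightarrow>
     continuous_on UNIV w \<and>
     (\<forall>x\<in>{mp_left \<alpha><..<mp_right \<alpha>}.
        w differentiable (at x) \<and>
        (deriv w has_real_derivative
           (x + (\<alpha> - 1)) / (pi * x * sqrt (4 * \<alpha> - (x - (\<alpha> + 1))\<^sup>2))) (at x)) \<and>
     (\<forall>x\<in>{..mp_left \<alpha>} \<union> {mp_right \<alpha>..}. w x = \<bar>x - \<alpha>\<bar>)"

(* For \<alpha> = 1 the left endpoint is 0, where the density takes the junk value 0;
   this concerns a single point. *)
definition marchenko_pastur :: "real \<Rightarrow> real measure" where
  "marchenko_pastur \<alpha> =
     density lborel (\<lambda>x. ennreal (indicator {mp_left \<alpha>..mp_right \<alpha>} x *
       (sqrt (4 * \<alpha> - (x - (\<alpha> + 1))\<^sup>2) / (2 * pi * x))))"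

end

theory Submission
  imports Defs
begin

text \<open>
On its arc, each curve has as second derivative a rational function times the arcsine density
\<open>1 / (\<pi> \<surd>(r\<^sup>2 - (x - c)\<^sup>2))\<close>, and the density of each measure is a rational function times the square
root itself. For the first curve \<open>c = 0\<close>, \<open>r = 2\<close>; for the second \<open>c = \<alpha> + 1\<close>, \<open>r = 2 \<surd>\<alpha>\<close>. So everything reduces to the
generating function \<open>A(z)\<close> of the moments of the arcsine law. Integrating the derivative of
\<open>x\<^sup>n \<surd>(r\<^sup>2 - (x - c)\<^sup>2)\<close>, which vanishes at both ends, gives a three-term recurrence for these moments
(\<open>arcsine_moment_recurrence\<close>). It says \<open>D A' = - D' A / 2\<close> with \<open>D = (1 - c z)\<^sup>2 - r\<^sup>2 z\<^sup>2\<close>, hence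
\<open>D A\<^sup>2 = 1\<close> (\<open>arcsine_moment_gf_square\<close>). Multiplying and dividing by the square root expresses the
moments of the semicircle density through those of the arcsine density, and their generating function
becomes \<open>(1 - c z - D A) / (2 z\<^sup>2)\<close> (\<open>semicircle_moment_gf\<close>).

On the side of the curves, integration by parts turns \<open>ptilde\<close> into half of a moment of the second
derivative on the arc (\<open>has_integral_ptilde\<close>), so the numbers \<open>ptilde k w\<close> are \<open>A\<^sub>k\<close> in the first case and
\<open>(A\<^sub>k + (\<alpha> - 1) A\<^sub>k\<^sub>-\<^sub>1) / 2\<close> in the second. An identity \<open>F = exp P\<close> of power series is equivalent to
\<open>F' = F P'\<close> together with the initial values (\<open>fps_eq_exp_compose_if_deriv\<close>), and with \<open>F\<close> and \<open>z P'\<close>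
known in terms of \<open>A\<close>, \<open>D\<close> and \<open>z\<close> the latter follows algebraically from \<open>D A\<^sup>2 = 1\<close>.

The remaining work is to solve the boundary value problem for the second curve. Its second derivative
has an elementary primitive (\<open>mp_slope\<close>), normalized so that its integral over the arc is the increment
that the boundary values prescribe (\<open>integral_mp_slope\<close>). It is \<open>1\<close> at the right end, and at the left end
\<open>-1\<close> or, for \<open>\<alpha> = 1\<close>, \<open>0\<close>, so that the curve is differentiable there or has
a kink at the origin. The solution is unique since
the difference of two solutions is affine on the arc and vanishes at both ends.
\<close>

section \<open>Exponentials of formal power series\<close>

text \<open>
The quotient of \<open>F\<close> by the exponential has derivative \<open>0\<close> and constant term \<open>1\<close>.
\<close>

lemma fps_eq_exp_compose_if_deriv:
  fixes F P :: "'a::field_char_0 fps"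
  assumes F0: "fps_nth F 0 = 1" and P0: "fps_nth P 0 = 0" and F': "fps_deriv F = F * fps_deriv P"
  shows "F = fps_compose (fps_exp 1) P"
proof -
  define E where "E = fps_compose (fps_exp 1) P"
  have E0: "fps_nth E 0 = 1" by (simp add: E_def)
  have E': "fps_deriv E = E * fps_deriv P"
    by (simp add: E_def fps_compose_deriv[OF P0])
  have Ei: "E * inverse E = 1" using inverse_mult_eq_1'[of E] E0 by simp
  have "fps_deriv (F * inverse E)
      = F * fps_deriv P * inverse E * (1 - E * inverse E)"
    using E0 by (simp add: F' E' fps_inverse_deriv power2_eq_square algebra_simps)
  then have "fps_deriv (F * inverse E) = 0" by (simp only: Ei) simp
  then have "F * inverse E = fps_const (fps_nth (F * inverse E) 0)"
    by (simp only: fps_deriv_eq_0_iff)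
  also have "fps_nth (F * inverse E) 0 = 1" using F0 E0 by simp
  finally have "F * inverse E = 1" by simp
  then have "F * (E * inverse E) = E"
    by (metis mult.assoc mult.commute mult_1)
  then show ?thesis unfolding Ei by (simp add: E_def)
qed

section \<open>Moments of the arcsine and semicircle densities\<close>

definition arcsine_density :: "real \<Rightarrow> real \<Rightarrow> real \<Rightarrow> real" where
  "arcsine_density c r x = 1 / (pi * sqrt (r\<^sup>2 - (x - c)\<^sup>2))"

definition arcsine_moment :: "real \<Rightarrow> real \<Rightarrow> nat \<Rightarrow> real" where
  "arcsine_moment c r n = integral {c - r..c + r} (\<lambda>x. x ^ n * arcsine_density c r x)"

lemma square_dist_center_less:
  fixes c r x :: real
  assumes "x \<in> {c - r<..<c + r}"
  shows "(x - c)\<^sup>2 < r\<^sup>2"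
proof -
  have "\<bar>x - c\<bar> < \<bar>r\<bar>" using assms by auto
  then show ?thesis by (metis abs_ge_zero power2_abs power_strict_mono pos2)
qed

lemma square_dist_center_le:
  fixes c r x :: real
  assumes "x \<in> {c - r..c + r}"
  shows "(x - c)\<^sup>2 \<le> r\<^sup>2"
proof -
  have "\<bar>x - c\<bar> \<le> \<bar>r\<bar>" using assms by auto
  then show ?thesis by (metis abs_ge_zero power2_abs power_mono)
qed

lemma arcsine_density_nonneg: "x \<in> {c - r..c + r} \<Longrightarrow> 0 \<le> arcsine_density c r x"
  using square_dist_center_le by (simp add: arcsine_density_def)

lemma arcsin_has_arcsine_density:
  assumes r: "0 < r" and x: "x \<in> {c - r<..<c + r}"
  shows "((\<lambda>x. arcsin ((x - c) / r) / pi) has_real_derivative arcsine_density c r x) (at x)"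
proof -
  have q: "0 < r\<^sup>2 - (x - c)\<^sup>2" using square_dist_center_less[OF x] by simp
  have "1 - ((x - c) / r)\<^sup>2 = (r\<^sup>2 - (x - c)\<^sup>2) / r\<^sup>2"
    unfolding power_divide using r by (simp add: diff_divide_distrib)
  then have s: "sqrt (1 - ((x - c) / r)\<^sup>2) = sqrt (r\<^sup>2 - (x - c)\<^sup>2) / r"
    using r by (simp add: real_sqrt_divide)
  have "-1 < (x - c) / r" "(x - c) / r < 1" using x r by (auto simp: field_simps)
  then have "((\<lambda>x. arcsin ((x - c) / r) / pi) has_real_derivative
      inverse (sqrt (1 - ((x - c) / r)\<^sup>2)) / r / pi) (at x)"
    by (auto intro!: derivative_eq_intros simp: divide_simps)
  also have "inverse (sqrt (1 - ((x - c) / r)\<^sup>2)) / r / pi = arcsine_density c r x"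
    unfolding s arcsine_density_def using r q by (simp add: field_simps)
  finally show ?thesis .
qed

lemma continuous_on_arcsin_affine:
  "0 < (r::real) \<Longrightarrow> continuous_on {c - r..c + r} (\<lambda>x. arcsin ((x - c) / r))"
  by (intro continuous_intros) (auto simp: field_simps)

lemma arcsine_density_has_integral_1:
  assumes r: "0 < r"
  shows "(arcsine_density c r has_integral 1) {c - r..c + r}"
proof -
  have "(arcsine_density c r has_integral
      (arcsin ((c + r - c) / r) / pi - arcsin ((c - r - c) / r) / pi)) {c - r..c + r}"
    using r arcsin_has_arcsine_density[OF r]
    by (intro fundamental_theorem_of_calculus_interior)
       (auto simp: has_real_derivative_iff_has_vector_derivative
             intro!: continuous_on_arcsin_affine continuous_intros)
  then show ?thesis using r by simp
qed

lemma power_mult_absolutely_integrable: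
  fixes f :: "real \<Rightarrow> real"
  assumes "f integrable_on {a..b}" and "\<And>x. x \<in> {a..b} \<Longrightarrow> 0 \<le> f x"
  shows "(\<lambda>x. x ^ n * f x) absolutely_integrable_on {a..b}"
proof (rule absolutely_integrable_bounded_measurable_product_real)
  have cont: "continuous_on {a..b} (\<lambda>x. x ^ n)" by (intro continuous_intros)
  then show "(\<lambda>x. x ^ n) \<in> borel_measurable (lebesgue_on {a..b})"
    by (rule continuous_imp_measurable_on_sets_lebesgue) simp
  show "bounded ((\<lambda>x. x ^ n) ` {a..b})"
    using compact_continuous_image[OF cont] by (simp add: compact_imp_bounded)
  show "f absolutely_integrable_on {a..b}"
    using assms by (intro nonnegative_absolutely_integrable_1)
qed simp

lemma has_integral_arcsine_moment:
  assumes r: "0 < r"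
  shows "((\<lambda>x. x ^ n * arcsine_density c r x) has_integral arcsine_moment c r n) {c - r..c + r}"
  unfolding arcsine_moment_def
  by (intro integrable_integral set_lebesgue_integral_eq_integral(1) power_mult_absolutely_integrable
        has_integral_integrable[OF arcsine_density_has_integral_1[OF r]] arcsine_density_nonneg)

lemma arcsine_moment_0: "0 < r \<Longrightarrow> arcsine_moment c r 0 = 1"
  using has_integral_arcsine_moment[where r = r and n = 0 and c = c] arcsine_density_has_integral_1[of r c]
  by (simp add: has_integral_unique)

text \<open>
Division by zero makes both sides vanish at the ends of the interval, so that no exceptional points
are needed when integrals are compared.
\<close>

lemma sqrt_eq_arcsine_density:
  assumes "x \<in> {c - r..c + r}"
  shows "sqrt (r\<^sup>2 - (x - c)\<^sup>2) = pi * (r\<^sup>2 - (x - c)\<^sup>2) * arcsine_density c r x"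
  using square_dist_center_le[OF assms]
  by (cases "r\<^sup>2 = (x - c)\<^sup>2") (simp_all add: arcsine_density_def real_div_sqrt)

text \<open>
The integral over the whole interval of the derivative of \<open>x\<^sup>n \<surd>(r\<^sup>2 - (x - c)\<^sup>2) / \<pi>\<close> is zero, and this
derivative is a combination of three consecutive powers of \<open>x\<close> times the arcsine density. For \<open>n = 0\<close>
the truncated index \<open>n - 1\<close> comes with the coefficient \<open>0\<close>.
\<close>

lemma arcsine_moment_recurrence:
  assumes r: "0 < r"
  shows "real (n + 1) * arcsine_moment c r (n + 1)
       = real (2 * n + 1) * c * arcsine_moment c r n
         + real n * (r\<^sup>2 - c\<^sup>2) * arcsine_moment c r (n - 1)"
proof -
  let ?d = "arcsine_density c r"
  let ?A = "arcsine_moment c r"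
  let ?f' = "\<lambda>x. real n * (r\<^sup>2 - c\<^sup>2) * (x ^ (n - 1) * ?d x)
     + real (2 * n + 1) * c * (x ^ n * ?d x) - real (n + 1) * (x ^ (n + 1) * ?d x)"
  have "(?f' has_integral
       real n * (r\<^sup>2 - c\<^sup>2) * ?A (n - 1) + real (2 * n + 1) * c * ?A n - real (n + 1) * ?A (n + 1))
       {c - r..c + r}"
    by (intro has_integral_diff has_integral_add has_integral_mult_right
              has_integral_arcsine_moment[OF r])
  moreover
  have "(?f' has_integral
     (c + r) ^ n * sqrt (r\<^sup>2 - (c + r - c)\<^sup>2) / pi - (c - r) ^ n * sqrt (r\<^sup>2 - (c - r - c)\<^sup>2) / pi)
     {c - r..c + r}"
  proof (rule fundamental_theorem_of_calculus_interior)
    show "continuous_on {c - r..c + r} (\<lambda>x. x ^ n * sqrt (r\<^sup>2 - (x - c)\<^sup>2) / pi)"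
      by (intro continuous_intros) auto
    fix x assume x: "x \<in> {c - r<..<c + r}"
    have q: "0 < r\<^sup>2 - (x - c)\<^sup>2" using square_dist_center_less[OF x] by simp
    let ?s = "sqrt (r\<^sup>2 - (x - c)\<^sup>2)"
    have s: "?s = pi * (r\<^sup>2 - (x - c)\<^sup>2) * ?d x"
      by (rule sqrt_eq_arcsine_density) (use x in auto)
    have i: "inverse ?s = pi * ?d x" by (simp add: arcsine_density_def field_simps)
    have "((\<lambda>x. x ^ n * sqrt (r\<^sup>2 - (x - c)\<^sup>2) / pi) has_real_derivative
        (real n * x ^ (n - 1) * ?s + x ^ n * (inverse ?s / 2 * (- (2 * (x - c))))) / pi) (at x)"
      using q by (auto intro!: derivative_eq_intros)
    also have "(real n * x ^ (n - 1) * ?s + x ^ n * (inverse ?s / 2 * (- (2 * (x - c))))) / pi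
       = (real n * x ^ (n - 1) * (r\<^sup>2 - (x - c)\<^sup>2) - x ^ n * (x - c)) * ?d x"
      unfolding i by (subst s) (simp add: field_simps)
    also have "\<dots> = ?f' x"
      by (cases n) (simp_all add: algebra_simps power2_eq_square)
    finally show "((\<lambda>x. x ^ n * sqrt (r\<^sup>2 - (x - c)\<^sup>2) / pi) has_vector_derivative ?f' x) (at x)"
      by (simp add: has_real_derivative_iff_has_vector_derivative)
  qed (use r in auto)
  then have "(?f' has_integral 0) {c - r..c + r}" by simp
  ultimately have "real n * (r\<^sup>2 - c\<^sup>2) * ?A (n - 1) + real (2 * n + 1) * c * ?A n
      - real (n + 1) * ?A (n + 1) = 0"
    by (rule has_integral_unique)
  then show ?thesis by linarith
qed

lemma arcsine_moment_1: "0 < r \<Longrightarrow> arcsine_moment c r 1 = c"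
  using arcsine_moment_recurrence[where r = r and n = 0 and c = c] by (simp add: arcsine_moment_0)

text \<open>
The polynomial \<open>(1 - c z)\<^sup>2 - r\<^sup>2 z\<^sup>2\<close>: up to the substitution \<open>x = 1 / z\<close> and a factor \<open>z\<^sup>2\<close>, it is
\<open>(x - c)\<^sup>2 - r\<^sup>2\<close>.
\<close>

definition arcsine_disc :: "real \<Rightarrow> real \<Rightarrow> real fps" where
  "arcsine_disc c r = 1 - fps_const (2 * c) * fps_X + fps_const (c\<^sup>2 - r\<^sup>2) * fps_X\<^sup>2"

lemma fps_deriv_arcsine_disc:
  "fps_deriv (arcsine_disc c r) = - 2 * (fps_const c - fps_const (c\<^sup>2 - r\<^sup>2) * fps_X)"
  by (simp add: arcsine_disc_def algebra_simps power2_eq_square numeral_fps_const)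

text \<open>
The recurrence for the moments, read coefficientwise. The right-hand side is \<open>- D' A / 2\<close> for the
discriminant \<open>D\<close>.
\<close>

lemma arcsine_moment_ode:
  fixes c r :: real
  assumes r: "0 < r"
  defines "A \<equiv> Abs_fps (arcsine_moment c r)"
  shows "arcsine_disc c r * fps_deriv A = (fps_const c - fps_const (c\<^sup>2 - r\<^sup>2) * fps_X) * A"
proof (rule fps_ext)
  fix n
  have *: "arcsine_disc c r * fps_deriv A = fps_deriv A - fps_const (2*c) * (fps_X * fps_deriv A)
     + fps_const (c\<^sup>2 - r\<^sup>2) * (fps_X * (fps_X * fps_deriv A))"
    by (simp add: arcsine_disc_def algebra_simps power2_eq_square)
  have **: "(fps_const c - fps_const (c\<^sup>2 - r\<^sup>2) * fps_X) * A
     = fps_const c * A - fps_const (c\<^sup>2 - r\<^sup>2) * (fps_X * A)"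
    by (simp add: algebra_simps)
  show "fps_nth (arcsine_disc c r * fps_deriv A) n
      = fps_nth ((fps_const c - fps_const (c\<^sup>2 - r\<^sup>2) * fps_X) * A) n"
  proof (cases n)
    case 0
    then show ?thesis unfolding * **
      by (simp add: A_def arcsine_moment_1[OF r, unfolded One_nat_def] arcsine_moment_0[OF r])
  next
    case (Suc m)
    then show ?thesis unfolding * **
      using arcsine_moment_recurrence[OF r, where n = n and c = c]
      by (cases m) (simp_all add: A_def algebra_simps)
  qed
qed

text \<open>
By the differential equation \<open>(D A\<^sup>2)' = 2 A D A' + D' A\<^sup>2 = 0\<close>. Thus \<open>A\<close> is \<open>D\<close> to the power \<open>-1/2\<close>, and
\<open>D A\<close> is the square root of \<open>D\<close>.
\<close>

lemma arcsine_moment_gf_square: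
  fixes c r :: real
  assumes r: "0 < r"
  defines "A \<equiv> Abs_fps (arcsine_moment c r)"
  shows "arcsine_disc c r * A * A = 1"
proof -
  let ?D = "arcsine_disc c r"
  have "fps_deriv (?D * A * A) = 2 * A * (?D * fps_deriv A) + fps_deriv ?D * (A * A)"
    by (simp add: algebra_simps)
  also have "\<dots> = 0"
    unfolding arcsine_moment_ode[OF r, of c, folded A_def] fps_deriv_arcsine_disc
    by (simp add: algebra_simps)
  finally have "?D * A * A = fps_const (fps_nth (?D * A * A) 0)"
    by (simp only: fps_deriv_eq_0_iff)
  also have "fps_nth (?D * A * A) 0 = 1"
    by (simp add: A_def arcsine_moment_0[OF r] arcsine_disc_def)
  finally show ?thesis by simp
qed

definition semicircle_moment :: "real \<Rightarrow> real \<Rightarrow> nat \<Rightarrow> real" where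
  "semicircle_moment c r n
     = integral {c - r..c + r} (\<lambda>x. x ^ n * (sqrt (r\<^sup>2 - (x - c)\<^sup>2) / (2 * pi)))"

lemma has_integral_semicircle_moment:
  "((\<lambda>x. x ^ n * (sqrt (r\<^sup>2 - (x - c)\<^sup>2) / (2 * pi))) has_integral semicircle_moment c r n)
     {c - r..c + r}"
  unfolding semicircle_moment_def
  by (intro integrable_integral integrable_continuous_real continuous_intros) auto

text \<open>
The square root is the product of \<open>r\<^sup>2 - (x - c)\<^sup>2\<close> with its own reciprocal; expanding the quadratic
factor leaves three arcsine moments.
\<close>

lemma semicircle_moment_eq_arcsine_moments:
  assumes r: "0 < r"
  shows "2 * semicircle_moment c r n = (r\<^sup>2 - c\<^sup>2) * arcsine_moment c r n
     + 2 * c * arcsine_moment c r (n + 1) - arcsine_moment c r (n + 2)"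
proof -
  let ?A = "arcsine_moment c r" and ?d = "arcsine_density c r"
  have "((\<lambda>x. (r\<^sup>2 - c\<^sup>2) * (x ^ n * ?d x) + 2 * c * (x ^ (n + 1) * ?d x) - x ^ (n + 2) * ?d x)
     has_integral ((r\<^sup>2 - c\<^sup>2) * ?A n + 2 * c * ?A (n + 1) - ?A (n + 2))) {c - r..c + r}"
    by (intro has_integral_diff has_integral_add has_integral_mult_right
              has_integral_arcsine_moment[OF r])
  moreover have "(r\<^sup>2 - c\<^sup>2) * (x ^ n * ?d x) + 2 * c * (x ^ (n + 1) * ?d x) - x ^ (n + 2) * ?d x
      = 2 * (x ^ n * (sqrt (r\<^sup>2 - (x - c)\<^sup>2) / (2 * pi)))" if "x \<in> {c - r..c + r}" for x
    by (subst sqrt_eq_arcsine_density[OF that])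
       (simp add: field_simps power2_eq_square)
  ultimately have "((\<lambda>x. 2 * (x ^ n * (sqrt (r\<^sup>2 - (x - c)\<^sup>2) / (2 * pi))))
     has_integral ((r\<^sup>2 - c\<^sup>2) * ?A n + 2 * c * ?A (n + 1) - ?A (n + 2))) {c - r..c + r}"
    by (rule has_integral_eq[rotated])
  then show ?thesis
    using has_integral_mult_right[OF has_integral_semicircle_moment[where n = n and r = r and c = c], of 2]
    by (simp add: has_integral_unique)
qed

lemma semicircle_moment_0: "semicircle_moment 0 2 0 = 1"
  using semicircle_moment_eq_arcsine_moments[where r = 2 and n = 0 and c = 0]
    arcsine_moment_recurrence[where r = 2 and n = 1 and c = 0]
  by (simp add: arcsine_moment_0 numeral_2_eq_2)

text \<open>
Multiplication by \<open>2 z\<^sup>2\<close> aligns the three shifted arcsine series into \<open>- D A\<close>; the terms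
\<open>1 - c z\<close> compensate for the first two coefficients.
\<close>

lemma semicircle_moment_gf:
  fixes c r :: real
  assumes r: "0 < r"
  defines "A \<equiv> Abs_fps (arcsine_moment c r)" and "B \<equiv> Abs_fps (semicircle_moment c r)"
  shows "2 * fps_X\<^sup>2 * B = 1 - fps_const c * fps_X - arcsine_disc c r * A"
proof (rule fps_ext)
  fix n
  have 2: "2 * fps_X\<^sup>2 * B = fps_const 2 * (fps_X * (fps_X * B))"
    by (simp add: power2_eq_square algebra_simps numeral_fps_const)
  have A: "arcsine_disc c r * A = A - fps_const (2*c) * (fps_X * A)
     + fps_const (c\<^sup>2 - r\<^sup>2) * (fps_X * (fps_X * A))"
    by (simp add: arcsine_disc_def algebra_simps power2_eq_square)
  consider "n = 0" | "n = 1" | m where "n = Suc (Suc m)"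
    by (metis One_nat_def not0_implies_Suc)
  then show "fps_nth (2 * fps_X\<^sup>2 * B) n = fps_nth (1 - fps_const c * fps_X - arcsine_disc c r * A) n"
  proof cases
    case 3
    then show ?thesis unfolding 2 A
      using semicircle_moment_eq_arcsine_moments[OF r, where c = c and n = m]
      by (simp add: A_def B_def algebra_simps)
  qed (simp_all add: 2 A, simp_all add: A_def arcsine_moment_0[OF r]
        arcsine_moment_1[OF r, unfolded One_nat_def])
qed

section \<open>The exponential formula for both pairs of moment sequences\<close>

text \<open>
With \<open>2 z\<^sup>2 F = 1 - D A\<close> and \<open>z P' = A - 1\<close>, both sides of \<open>F' = F P'\<close> become polynomials in \<open>z\<close>, \<open>A\<close>
and \<open>D A\<close> after multiplication by \<open>2 z\<^sup>3\<close>, and they agree because \<open>D A\<^sup>2 = 1\<close>.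
\<close>

lemma semicircle_moment_exp_formula:
  "Abs_fps (semicircle_moment 0 2) =
    fps_compose (fps_exp 1) (Abs_fps (\<lambda>k. if k = 0 then 0 else arcsine_moment 0 2 k / real k))"
proof -
  define A where "A = Abs_fps (arcsine_moment 0 2)"
  define F where "F = Abs_fps (semicircle_moment 0 2)"
  define P where "P = Abs_fps (\<lambda>k. if k = 0 then 0 else arcsine_moment 0 2 k / real k)"
  define D where "D = arcsine_disc 0 2"
  have D: "D = 1 - 4 * fps_X\<^sup>2"
    by (simp add: D_def arcsine_disc_def numeral_fps_const)
  have F: "2 * fps_X\<^sup>2 * F = 1 - D * A"
    using semicircle_moment_gf[of 2 0] by (simp add: A_def F_def D_def)
  have DAA: "D * A * A = 1"
    using arcsine_moment_gf_square[of 2 0] by (simp add: A_def D_def)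
  have A': "D * fps_deriv A = 4 * fps_X * A"
    using arcsine_moment_ode[of 2 0]
    by (simp add: A_def D_def numeral_fps_const mult_minus_left[symmetric] del: mult_minus_left)
  have P': "fps_X * fps_deriv P = A - 1"
    by (rule fps_ext) (auto simp: P_def A_def arcsine_moment_0)
  have "fps_deriv (2 * fps_X\<^sup>2 * F) = fps_deriv (1 - D * A)" by (simp only: F)
  moreover have "fps_deriv D = - 8 * fps_X" by (simp add: D power2_eq_square algebra_simps)
  ultimately have "4 * fps_X * F + 2 * fps_X\<^sup>2 * fps_deriv F = 8 * fps_X * A - D * fps_deriv A"
    by (simp add: power2_eq_square algebra_simps)
  then have F': "4 * fps_X * F + 2 * fps_X\<^sup>2 * fps_deriv F = 4 * fps_X * A"
    unfolding A' by (simp add: algebra_simps)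
  have "2 * fps_X\<^sup>2 * fps_X * (fps_deriv F - F * fps_deriv P) =
     fps_X * (4 * fps_X * F + 2 * fps_X\<^sup>2 * fps_deriv F)
      - 2 * (2 * fps_X\<^sup>2 * F) - 2 * fps_X\<^sup>2 * F * (fps_X * fps_deriv P)"
    by (simp add: algebra_simps power2_eq_square)
  also have "\<dots> = fps_X * (4 * fps_X * A) - 2 * (1 - D * A) - (1 - D * A) * (A - 1)"
    unfolding F' F P' ..
  also have "\<dots> = (4 * fps_X\<^sup>2 + D - 1) * A + (D * A * A - 1)"
    by (simp add: algebra_simps power2_eq_square)
  also have "\<dots> = 0" unfolding DAA by (simp add: D)
  \<comment> \<open>power series over a field have no zero divisors, so the powers of \<open>z\<close> cancel\<close>
  finally have F'P: "fps_deriv F = F * fps_deriv P"  by simp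
  show ?thesis
    using fps_eq_exp_compose_if_deriv[OF _ _ F'P] by (simp add: F_def P_def semicircle_moment_0)
qed

text \<open>
The density of the Marchenko-Pastur law is the semicircle density divided by \<open>x\<close>, which shifts its
moments by one. With \<open>b = \<alpha> - 1\<close> the discriminant is \<open>D = 1 - 2 (b + 2) z + b\<^sup>2 z\<^sup>2\<close>, and
\<open>2 z F = 1 - b z - D A\<close>, \<open>2 z P' = A - 1 + b z A\<close>. Again \<open>F' = F P'\<close> is a consequence of \<open>D A\<^sup>2 = 1\<close>.
\<close>

lemma marchenko_pastur_exp_formula:
  fixes \<alpha> :: real
  assumes \<alpha>: "0 < \<alpha>"
  defines "c \<equiv> \<alpha> + 1" and "r \<equiv> 2 * sqrt \<alpha>"
  shows "Abs_fps (\<lambda>k. if k = 0 then 1 else semicircle_moment c r (k - 1)) =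
    fps_compose (fps_exp 1) (Abs_fps (\<lambda>k. if k = 0 then 0 else
      ((arcsine_moment c r k + (\<alpha> - 1) * arcsine_moment c r (k - 1)) / 2) / real k))"
proof -
  define A where "A = Abs_fps (arcsine_moment c r)"
  define F where "F = Abs_fps (\<lambda>k. if k = 0 then 1 else semicircle_moment c r (k - 1))"
  define P where "P = Abs_fps (\<lambda>k. if k = 0 then 0 else
      ((arcsine_moment c r k + (\<alpha> - 1) * arcsine_moment c r (k - 1)) / 2) / real k)"
  define D where "D = arcsine_disc c r"
  define b where "b = fps_const (\<alpha> - 1)"
  have r: "0 < r" using \<alpha> by (simp add: r_def)
  have cr: "c\<^sup>2 - r\<^sup>2 = (\<alpha> - 1)\<^sup>2"
    using \<alpha> by (simp add: c_def r_def power2_eq_square algebra_simps)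
  have C: "fps_const c = b + 2" by (simp add: b_def c_def numeral_fps_const)
  have bb: "fps_const (c\<^sup>2 - r\<^sup>2) = b * b"
    unfolding cr by (simp add: b_def power2_eq_square)
  have c2: "fps_const (2 * c) = 2 * (b + 2)" by (simp add: b_def c_def numeral_fps_const)
  have D: "D = 1 - 2 * (b + 2) * fps_X + b * b * fps_X\<^sup>2"
    unfolding D_def arcsine_disc_def bb c2 ..
  have D': "fps_deriv D = - 2 * ((b + 2) - b * b * fps_X)"
    unfolding D_def fps_deriv_arcsine_disc bb C ..
  have F1: "F = 1 + fps_X * Abs_fps (semicircle_moment c r)"
    by (rule fps_ext) (auto simp: F_def)
  have "fps_X * (2 * fps_X * F)
     = 2 * fps_X\<^sup>2 + fps_X * (2 * fps_X\<^sup>2 * Abs_fps (semicircle_moment c r))"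
    unfolding F1 by (simp add: algebra_simps power2_eq_square)
  also have "\<dots> = fps_X * (1 - b * fps_X - D * A)"
    unfolding semicircle_moment_gf[OF r] C
    by (simp add: algebra_simps power2_eq_square A_def D_def)
  finally have F: "2 * fps_X * F = 1 - b * fps_X - D * A" by simp
  have DAA: "D * A * A = 1"
    using arcsine_moment_gf_square[of r c] r by (simp add: A_def D_def)
  have A': "D * fps_deriv A = ((b + 2) - b * b * fps_X) * A"
    using arcsine_moment_ode[OF r, of c] unfolding C bb by (simp add: A_def D_def)
  have P': "2 * (fps_X * fps_deriv P) = A - 1 + b * fps_X * A"
  proof -
    have "2 * (fps_X * fps_deriv P) = fps_const 2 * (fps_X * fps_deriv P)"
      by (simp add: numeral_fps_const)
    moreover have "b * fps_X * A = fps_const (\<alpha> - 1) * (fps_X * A)" by (simp add: b_def)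
    ultimately show ?thesis
      by (simp only:, intro fps_ext) (auto simp: P_def A_def arcsine_moment_0[OF r])
  qed
  have "fps_deriv (2 * fps_X * F) = fps_deriv (1 - b * fps_X - D * A)" by (simp only: F)
  then have "2 * F + 2 * fps_X * fps_deriv F = - b - D * fps_deriv A - fps_deriv D * A"
    by (simp add: algebra_simps b_def)
  then have F': "2 * F + 2 * fps_X * fps_deriv F = - b + ((b + 2) - b * b * fps_X) * A"
    unfolding A' D' by (simp add: algebra_simps)
  have "4 * fps_X * fps_X * (fps_deriv F - F * fps_deriv P) =
     2 * fps_X * (2 * F + 2 * fps_X * fps_deriv F) - 2 * (2 * fps_X * F)
       - (2 * fps_X * F) * (2 * (fps_X * fps_deriv P))"
    by (simp add: algebra_simps)
  also have "\<dots> = 2 * fps_X * (- b + ((b + 2) - b * b * fps_X) * A)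
      - 2 * (1 - b * fps_X - D * A) - (1 - b * fps_X - D * A) * (A - 1 + b * fps_X * A)"
    unfolding F F' P' ..
  also have "\<dots> = (D * A * A - 1) * (1 + b * fps_X)
      + A * (D - (1 - 2 * (b + 2) * fps_X + b * b * fps_X\<^sup>2))"
    by (simp add: algebra_simps power2_eq_square)
  also have "\<dots> = 0" unfolding DAA by (simp add: D)
  \<comment> \<open>power series over a field have no zero divisors, so the powers of \<open>z\<close> cancel\<close>
  finally have F'P: "fps_deriv F = F * fps_deriv P" by simp
  show ?thesis
    using fps_eq_exp_compose_if_deriv[OF _ _ F'P] by (simp add: F_def P_def)
qed

section \<open>Diagrams with a single smooth convex arc\<close>

text \<open>
Diagrams that follow \<open>\<bar>x - x0\<bar>\<close> outside \<open>[a, b]\<close> and are convex with slope \<open>g\<close> and curvature \<open>h\<close>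
inside. The slope need not continue that of \<open>\<bar>x - x0\<bar>\<close> at the left end if \<open>a = 0\<close>: a kink at the origin
contributes a point mass at \<open>0\<close> to the second derivative, and the moments of positive order do not see
it. This happens for the Marchenko-Pastur curve with \<open>\<alpha> = 1\<close>.
\<close>

locale arc_diagram =
  fixes w g h :: "real \<Rightarrow> real" and a b x0 :: real
  assumes ab: "a < b" and b_pos: "0 < b" and center: "a \<le> x0" "x0 \<le> b"
    and w_left: "\<And>x. x \<le> a \<Longrightarrow> w x = x0 - x"
    and w_right: "\<And>x. b \<le> x \<Longrightarrow> w x = x - x0"
    and w_cont: "continuous_on {a..b} w"
    and w_deriv: "\<And>x. x \<in> {a<..<b} \<Longrightarrow> (w has_real_derivative g x) (at x)"
    and g_cont: "continuous_on {a..b} g"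
    and g_deriv: "\<And>x. x \<in> {a<..<b} \<Longrightarrow> (g has_real_derivative h x) (at x)"
    and h_nonneg: "\<And>x. x \<in> {a<..<b} \<Longrightarrow> 0 \<le> h x"
    and g_left: "g a = -1 \<or> (a = 0 \<and> -1 \<le> g a)"
    and g_right: "g b = 1"
begin

lemma g_mono:
  assumes "a \<le> x" "x \<le> y" "y \<le> b"
  shows "g x \<le> g y"
proof (rule DERIV_nonneg_imp_increasing_open[OF \<open>x \<le> y\<close>])
  show "continuous_on {x..y} g"
    using g_cont by (rule continuous_on_subset) (use assms in auto)
  show "\<exists>d. DERIV g z :> d \<and> d \<ge> 0" if "x < z" "z < y" for z
    using g_deriv[of z] h_nonneg[of z] that assms by auto
qed

lemma g_ge: "a \<le> x \<Longrightarrow> x \<le> b \<Longrightarrow> -1 \<le> g x"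
  using g_mono[of a x] g_left by auto

lemma g_le: "a \<le> x \<Longrightarrow> x \<le> b \<Longrightarrow> g x \<le> 1"
  using g_mono[of x b] g_right by auto

lemma w_lipschitz_on_arc:
  assumes "a \<le> x" "x \<le> y" "y \<le> b"
  shows "\<bar>w y - w x\<bar> \<le> y - x"
proof (cases "x = y")
  case False
  then have xy: "x < y" using assms by simp
  have "\<exists>l z. z > x \<and> z < y \<and> DERIV w z :> l \<and> w y - w x = (y - x) * l"
  proof (rule MVT[OF xy])
    show "continuous_on {x..y} w"
      using w_cont by (rule continuous_on_subset) (use assms in auto)
    show "w differentiable at z" if "x < z" "z < y" for z
      using w_deriv[of z] that assms by (auto simp: real_differentiable_def)
  qed
  then obtain l z where z: "x < z" "z < y" and l: "DERIV w z :> l" "w y - w x = (y - x) * l"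
    by blast
  have "l = g z" using DERIV_unique[OF l(1) w_deriv[of z]] z assms by auto
  then have "\<bar>l\<bar> \<le> 1" using g_ge[of z] g_le[of z] z assms by auto
  then have "\<bar>(y - x) * l\<bar> \<le> (y - x) * 1"
    using xy by (simp only: abs_mult) (intro mult_mono, auto)
  then show ?thesis using l(2) by simp
qed simp

lemma w_lipschitz: "\<bar>w x - w y\<bar> \<le> \<bar>x - y\<bar>"
proof -
  have *: "\<bar>w y - w x\<bar> \<le> y - x" if "x \<le> y" for x y
  proof -
    have Ma: "\<bar>w y - w a\<bar> \<le> y - a" if "a \<le> y" "y \<le> b"
      using w_lipschitz_on_arc[of a y] that by simp
    have Mb: "\<bar>w b - w x\<bar> \<le> b - x" if "a \<le> x" "x \<le> b"
      using w_lipschitz_on_arc[of x b] that by simp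
    have Mab: "\<bar>w b - w a\<bar> \<le> b - a" using w_lipschitz_on_arc[of a b] ab by simp
    have Mxy: "\<bar>w y - w x\<bar> \<le> y - x" if "a \<le> x" "y \<le> b"
      using w_lipschitz_on_arc[of x y] that \<open>x \<le> y\<close> by simp
    note wa = w_left[of a] and wb = w_right[of b]
    consider "y \<le> a" | "x \<le> a" "a \<le> y" "y \<le> b" | "x \<le> a" "b \<le> y"
      | "a \<le> x" "y \<le> b" | "a \<le> x" "x \<le> b" "b \<le> y" | "b \<le> x"
      using that ab by linarith
    then show ?thesis
    proof cases
      case 1 then show ?thesis using w_left[of x] w_left[of y] that by auto
    next
      case 2 then show ?thesis using w_left[of x] wa Ma by linarith
    next
      case 3 then show ?thesis using w_left[of x] wa w_right[of y] wb Mab by linarith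
    next
      case 4 then show ?thesis using Mxy by simp
    next
      case 5 then show ?thesis using w_right[of y] wb Mb by linarith
    next
      case 6 then show ?thesis using w_right[of x] w_right[of y] that by auto
    qed
  qed
  show ?thesis using *[of x y] *[of y x] by linarith
qed

text \<open>
The slope increases from at least \<open>-1\<close> to \<open>1\<close>, so the mean value theorem gives the Lipschitz bound.
\<close>

lemma continual_young_diagram: "continual_young_diagram w"
proof -
  have "w x = \<bar>x - x0\<bar>" if "\<bar>a\<bar> + \<bar>b\<bar> \<le> \<bar>x\<bar>" for x
    using that center w_left[of x] w_right[of x] by linarith
  then show ?thesis unfolding continual_young_diagram_def using w_lipschitz by blast
qed

text \<open>
The slope of the whole diagram, with values at the ends of the arc that keep it monotone; monotonicity
yields measurability.
\<close>

definition slope :: "real \<Rightarrow> real" where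
  "slope x = (if x < a then -1 else if x \<le> b then g x else 1)"

lemma slope_mono: "mono slope"
proof (rule monoI)
  fix x y :: real
  assume "x \<le> y"
  then show "slope x \<le> slope y"
    using g_mono[of x y] g_ge[of y] g_le[of x] by (simp add: slope_def)
qed

lemma deriv_charge:
  assumes "x \<noteq> a" "x \<noteq> b" "x \<noteq> 0"
  shows "deriv (charge w) x = (slope x - sgn x) / 2"
proof (rule DERIV_imp_deriv)
  have abs: "(abs has_real_derivative sgn x) (at x)"
  proof (cases "0 < x")
    case True
    then show ?thesis
      by (rule_tac has_field_derivative_transform_within_open[of "\<lambda>x. x" _ _ "{0<..}"])
         (auto intro!: derivative_eq_intros)
  next
    case False
    then show ?thesis using assms
      by (rule_tac has_field_derivative_transform_within_open[of "\<lambda>x. - x" _ _ "{..<0}"])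
         (auto intro!: derivative_eq_intros)
  qed
  have w: "(w has_real_derivative slope x) (at x)"
  proof -
    consider "x < a" | "a < x" "x < b" | "b < x" using assms by linarith
    then show ?thesis
    proof cases
      case 1
      then show ?thesis
        by (rule_tac has_field_derivative_transform_within_open[of "\<lambda>x. x0 - x" _ _ "{..<a}"])
           (auto simp: slope_def w_left intro!: derivative_eq_intros)
    next
      case 2
      then show ?thesis using w_deriv[of x] by (simp add: slope_def)
    next
      case 3
      then show ?thesis using ab
        by (rule_tac has_field_derivative_transform_within_open[of "\<lambda>x. x - x0" _ _ "{b<..}"])
           (auto simp: slope_def w_right intro!: derivative_eq_intros)
    qed
  qed
  show "(charge w has_real_derivative (slope x - sgn x) / 2) (at x)"
    unfolding charge_def[abs_def] using w abs by (auto intro!: derivative_eq_intros)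
qed

lemma slope_eq_sgn_outside: "x \<notin> {min a 0..b} \<Longrightarrow> slope x = sgn x"
  using b_pos ab by (auto simp: slope_def)

text \<open>
The Lebesgue integral over the line, rewritten as a gauge integral over a compact interval. The derivative
of the charge vanishes outside the smallest interval that contains the arc and the origin.
\<close>

lemma ptilde_eq_slope_integral:
  "((\<lambda>x. real k * (x ^ (k - 1) * (slope x - sgn x) / 2)) has_integral - ptilde k w) {min a 0..b}"
proof -
  let ?L = "min a 0"
  let ?T = "\<lambda>x. x ^ (k - 1) * (slope x - sgn x) / 2"
  have [measurable]: "slope \<in> borel_measurable borel"
    by (rule borel_measurable_mono[OF slope_mono])
  have T_meas: "?T \<in> borel_measurable borel" by measurable
  have T_out: "?T x = 0" if "x \<notin> {?L..b}" for x
    using slope_eq_sgn_outside[OF that] by simp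
  have T_bound: "norm (?T x) \<le> (\<bar>a\<bar> + b) ^ (k - 1)" if "x \<in> {?L..b}" for x
  proof -
    have "\<bar>x\<bar> ^ (k - 1) \<le> (\<bar>a\<bar> + b) ^ (k - 1)" using that b_pos by (intro power_mono) auto
    moreover have "\<bar>slope x\<bar> \<le> 1" using g_ge[of x] g_le[of x] by (auto simp: slope_def)
    then have "\<bar>slope x - sgn x\<bar> / 2 \<le> 1" by (auto simp: sgn_if)
    ultimately have "\<bar>x\<bar> ^ (k - 1) * (\<bar>slope x - sgn x\<bar> / 2) \<le> (\<bar>a\<bar> + b) ^ (k - 1) * 1"
      using b_pos by (intro mult_mono) auto
    then show ?thesis by (simp add: abs_mult power_abs)
  qed
  have T_int: "integrable lborel ?T"
  proof (rule integrableI_bounded_set[where A = "{?L..b}"])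
    show "AE x in lborel. x \<in> {?L..b} \<longrightarrow> norm (?T x) \<le> (\<bar>a\<bar> + b) ^ (k - 1)"
      using T_bound by simp
    show "AE x in lborel. x \<notin> {?L..b} \<longrightarrow> ?T x = 0" using T_out by blast
    show "emeasure lborel {?L..b} < \<infinity>" by (simp add: emeasure_lborel_Icc_eq)
  qed (use T_meas in simp_all)
  have "(\<integral>x. x ^ (k - 1) * deriv (charge w) x \<partial>lebesgue) = (\<integral>x. ?T x \<partial>lebesgue)"
  proof -
    have "AE x in lebesgue. x \<notin> {a, b, 0}"
      by (intro AE_completion AE_not_in finite_imp_null_set_lborel) simp
    then have ae: "AE x in lebesgue. ?T x = x ^ (k - 1) * deriv (charge w) x"
      by eventually_elim (use deriv_charge in auto)
    have T': "?T \<in> borel_measurable lebesgue" using T_meas by (simp add: measurable_completion)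
    show ?thesis
      using borel_measurable_AE[OF T' ae] T' ae by (intro integral_cong_AE) auto
  qed
  also have "\<dots> = (\<integral>x. ?T x \<partial>lborel)"
    using T_meas by (intro integral_completion) simp
  finally have p: "real k * (\<integral>x. ?T x \<partial>lborel) = - ptilde k w" by (simp add: ptilde_def)
  have "(?T has_integral (\<integral>x. ?T x \<partial>lborel)) UNIV"
    by (rule has_integral_integral_lborel[OF T_int])
  then have "((\<lambda>x. if x \<in> {?L..b} then ?T x else 0) has_integral (\<integral>x. ?T x \<partial>lborel)) UNIV"
    by (rule has_integral_eq[rotated]) (use T_out in simp)
  then have "(?T has_integral (\<integral>x. ?T x \<partial>lborel)) {?L..b}"
    by (subst (asm) has_integral_restrict_UNIV)
  from has_integral_mult_right[OF this, of "real k"] show ?thesis unfolding p .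
qed

text \<open>
The factor \<open>x\<^sup>k\<close> removes the jump of the slope that is possible at \<open>a = 0\<close>.
\<close>

lemma continuous_on_power_slope:
  assumes k: "0 < k"
  shows "continuous_on {min a 0..b} (\<lambda>x. x ^ k * slope x)"
proof -
  have "continuous_on ({min a 0..a} \<union> {a..b}) (\<lambda>x. if x < a then - (x ^ k) else x ^ k * g x)"
  proof (rule continuous_on_cases)
    show "continuous_on {a..b} (\<lambda>x. x ^ k * g x)" by (intro continuous_intros g_cont)
    show "\<forall>x. (x \<in> {min a 0..a} \<and> \<not> x < a) \<or> (x \<in> {a..b} \<and> x < a) \<longrightarrow> - (x ^ k) = x ^ k * g x"
      using g_left k by (auto simp: power_0_left)
  qed (auto intro!: continuous_intros)
  moreover have "{min a 0..a} \<union> {a..b} = {min a 0..b}" using ab by auto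
  ultimately show ?thesis
    by (rule_tac continuous_on_eq[where f = "\<lambda>x. if x < a then - (x ^ k) else x ^ k * g x"])
       (auto simp: slope_def)
qed

text \<open>
Integration by parts: the function \<open>x\<^sup>k (slope x - sgn x) / 2\<close> is continuous, even at the origin since
\<open>k > 0\<close>, and vanishes at both ends of the interval. The integral of its derivative is therefore zero,
and this derivative is the integrand of \<open>- ptilde k w\<close> plus half of \<open>x\<^sup>k h x\<close>.
\<close>

theorem has_integral_ptilde:
  assumes k: "0 < k"
  shows "((\<lambda>x. x ^ k * h x) has_integral 2 * ptilde k w) {a..b}"
proof -
  let ?L = "min a 0"
  let ?F = "\<lambda>x. x ^ k * ((slope x - sgn x) / 2)"
  let ?h = "\<lambda>x. if x \<in> {a..b} then x ^ k * h x else 0"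
  let ?f = "\<lambda>x. real k * (x ^ (k - 1) * (slope x - sgn x) / 2) + ?h x / 2"
  have "(?f has_integral ?F b - ?F ?L) {?L..b}"
  proof (rule fundamental_theorem_of_calculus_interior_strong[where S = "{a, 0}"])
    have "x ^ k * sgn x = x ^ (k - 1) * \<bar>x\<bar>" for x :: real
      using k by (cases k) (auto simp: abs_if sgn_if)
    then have "continuous_on {?L..b} (\<lambda>x::real. x ^ k * sgn x)"
      by (simp only:) (intro continuous_intros)
    then have "continuous_on {?L..b} (\<lambda>x. (x ^ k * slope x - x ^ k * sgn x) / 2)"
      by (intro continuous_on_divide continuous_on_diff continuous_on_const
            continuous_on_power_slope[OF k]) simp_all
    then show "continuous_on {?L..b} ?F" by (simp add: algebra_simps)
    fix x assume x: "x \<in> {?L<..<b} - {a, 0}"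
    have s: "(slope has_real_derivative (if x < a then 0 else h x)) (at x)"
    proof (cases "x < a")
      case True
      then show ?thesis
        by (auto intro!: has_field_derivative_transform_within_open[of "\<lambda>x. -1" _ _ "{..<a}"]
              derivative_eq_intros simp: slope_def)
    next
      case False
      then have "x \<in> {a<..<b}" using x by auto
      with False show ?thesis
        by (auto intro!: has_field_derivative_transform_within_open[of g _ _ "{a<..<b}"] g_deriv
              simp: slope_def)
    qed
    have sg: "(sgn has_real_derivative 0) (at x)"
    proof (cases "x < 0")
      case True
      then show ?thesis
        by (auto intro!: has_field_derivative_transform_within_open[of "\<lambda>x. -1" _ _ "{..<0}"]
              derivative_eq_intros)
    next
      case False
      then show ?thesis using x
        by (auto intro!: has_field_derivative_transform_within_open[of "\<lambda>x. 1" _ _ "{0<..}"]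
              derivative_eq_intros)
    qed
    have "(?F has_real_derivative real k * x ^ (k - 1) * ((slope x - sgn x) / 2)
        + x ^ k * (((if x < a then 0 else h x) - 0) / 2)) (at x)"
      by (auto intro!: derivative_eq_intros s sg)
    also have "real k * x ^ (k - 1) * ((slope x - sgn x) / 2)
        + x ^ k * (((if x < a then 0 else h x) - 0) / 2) = ?f x"
      using x by auto
    finally show "(?F has_vector_derivative ?f x) (at x)"
      by (simp only: has_real_derivative_iff_has_vector_derivative)
  qed (use b_pos in auto)
  moreover have "?F b = 0" using b_pos g_right ab by (simp add: slope_def)
  moreover have "?F ?L = 0"
  proof (cases "a < 0")
    case True
    then show ?thesis using g_left ab by (simp add: slope_def)
  qed (use k in simp)
  ultimately have "(?f has_integral 0) {?L..b}" by (simp only: diff_zero)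
  from has_integral_diff[OF this ptilde_eq_slope_integral[of k]]
  have "((\<lambda>x. ?h x / 2) has_integral ptilde k w) {?L..b}" by simp
  from has_integral_mult_right[OF this, of 2]
  have "(?h has_integral 2 * ptilde k w) {?L..b}" by simp
  then show ?thesis by (subst (asm) has_integral_restrict) auto
qed

end

section \<open>Transition measures given by a density on an interval\<close>

lemma is_transition_measure_density:
  fixes f :: "real \<Rightarrow> real"
  assumes f_meas [measurable]: "f \<in> borel_measurable borel"
    and f_nonneg: "\<And>x. x \<in> {a..b} \<Longrightarrow> 0 \<le> f x"
    and f_moments: "\<And>n. ((\<lambda>x. x ^ n * f x) has_integral m n) {a..b}"
    and m0: "m 0 = 1"
    and exp_formula: "Abs_fps m =
       fps_compose (fps_exp 1) (Abs_fps (\<lambda>k. if k = 0 then 0 else ptilde k w / real k))"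
  shows "is_transition_measure (density lborel (\<lambda>x. ennreal (indicator {a..b} x * f x))) w"
proof -
  let ?f = "\<lambda>x. indicator {a..b} x * f x"
  let ?M = "density lborel (\<lambda>x. ennreal (?f x))"
  have f0: "0 \<le> ?f x" for x using f_nonneg[of x] by (simp add: indicator_def)
  have abs: "(\<lambda>x. x ^ n * f x) absolutely_integrable_on {a..b}" for n
    using f_moments[of 0] f_nonneg by (intro power_mult_absolutely_integrable) auto
  have lint: "integrable lborel (\<lambda>x. ?f x * x ^ n)" for n
  proof -
    have "integrable lebesgue (\<lambda>x. ?f x * x ^ n)"
      using abs[of n] by (simp add: set_integrable_def mult_ac)
    then show ?thesis by (subst (asm) integrable_completion) auto
  qed
  have lval: "(\<integral>x. ?f x * x ^ n \<partial>lborel) = m n" for n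
  proof -
    have "((\<lambda>x. ?f x * x ^ n) has_integral (\<integral>x. ?f x * x ^ n \<partial>lborel)) UNIV"
      by (rule has_integral_integral_lborel[OF lint])
    moreover have "(\<lambda>x. ?f x * x ^ n) = (\<lambda>x. if x \<in> {a..b} then x ^ n * f x else 0)"
      by (auto simp: indicator_def)
    ultimately have "((\<lambda>x. x ^ n * f x) has_integral (\<integral>x. ?f x * x ^ n \<partial>lborel)) {a..b}"
      by (simp only: has_integral_restrict_UNIV)
    then show ?thesis using f_moments[of n] by (rule has_integral_unique)
  qed
  have "prob_space ?M"
  proof (rule prob_spaceI)
    have "emeasure ?M (space ?M) = (\<integral>\<^sup>+ x. ennreal (?f x) \<partial>lborel)"
      by (simp add: emeasure_density)
    also have "\<dots> = ennreal (\<integral>x. ?f x \<partial>lborel)"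
      using lint[of 0] f0 by (intro nn_integral_eq_integral) auto
    also have "(\<integral>x. ?f x \<partial>lborel) = 1" using lval[of 0] m0 by simp
    finally show "emeasure ?M (space ?M) = 1" by simp
  qed
  moreover have "AE x in ?M. x \<in> {a..b}"
    by (subst AE_density) (auto simp: indicator_def)
  moreover have "moment ?M n = m n" for n
    unfolding moment_def lval[symmetric] using f0
    by (subst integral_density) auto
  then have "1 + Abs_fps (\<lambda>k. if k = 0 then 0 else moment ?M k) = Abs_fps m"
    by (intro fps_ext) (auto simp: m0)
  ultimately show ?thesis
    unfolding is_transition_measure_def using exp_formula by (auto intro!: exI[of _ "{a..b}"])
qed

section \<open>The Vershik-Kerov-Logan-Shepp curve and the semicircle law\<close>

lemma arc_diagram_vkls_curve:
  "arc_diagram vkls_curve (\<lambda>x. 2 * (arcsin (x / 2) / pi)) (\<lambda>x. 2 * arcsine_density 0 2 x) (-2) 2 0"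
proof
  let ?V = "\<lambda>x::real. 2 / pi * (x * arcsin (x / 2) + sqrt (4 - x\<^sup>2))"
  have V: "vkls_curve x = ?V x" if "x \<in> {-2..2}" for x
    using that by (auto simp: vkls_curve_def abs_le_iff)
  show "vkls_curve x = 0 - x" if "x \<le> -2" for x
  proof (cases "x = -2")
    case True then show ?thesis by (simp add: vkls_curve_def)
  qed (use that in \<open>simp add: vkls_curve_def\<close>)
  show "vkls_curve x = x - 0" if "2 \<le> x" for x
  proof (cases "x = 2")
    case True then show ?thesis by (simp add: vkls_curve_def)
  qed (use that in \<open>simp add: vkls_curve_def\<close>)
  have "continuous_on {-2..2} ?V"
    by (intro continuous_intros) auto
  then show "continuous_on {-2..2} vkls_curve"
    by (rule continuous_on_eq) (simp add: V)
  have A: "((\<lambda>x. arcsin (x / 2) / pi) has_real_derivative arcsine_density 0 2 x) (at x)"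
    if "x \<in> {-2<..<2}" for x
    using arcsin_has_arcsine_density[of 2 x 0] that by simp
  show "((\<lambda>x. 2 * (arcsin (x / 2) / pi)) has_real_derivative 2 * arcsine_density 0 2 x) (at x)"
    if "x \<in> {-2<..<2}" for x
    using A[OF that] by (rule DERIV_cmult)
  show "(vkls_curve has_real_derivative 2 * (arcsin (x / 2) / pi)) (at x)"
    if x: "x \<in> {-2<..<2}" for x
  proof (rule has_field_derivative_transform_within_open[where S = "{-2<..<2}"])
    have q: "0 < 4 - x\<^sup>2" using square_dist_center_less[of x 0 2] x by simp
    have s: "((\<lambda>x. sqrt (4 - x\<^sup>2)) has_real_derivative - x / sqrt (4 - x\<^sup>2)) (at x)"
      using q by (auto intro!: derivative_eq_intros simp: field_simps)
    have "((\<lambda>x. 2 * (x * (arcsin (x / 2) / pi)) + 2 / pi * sqrt (4 - x\<^sup>2)) has_real_derivative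
        2 * (x * arcsine_density 0 2 x + 1 * (arcsin (x / 2) / pi))
         + 2 / pi * (- x / sqrt (4 - x\<^sup>2))) (at x)"
      by (intro DERIV_add DERIV_cmult DERIV_mult' DERIV_ident A x s)
    also have "2 * (x * arcsine_density 0 2 x + 1 * (arcsin (x / 2) / pi))
         + 2 / pi * (- x / sqrt (4 - x\<^sup>2)) = 2 * (arcsin (x / 2) / pi)"
      by (simp add: arcsine_density_def algebra_simps)
    finally show "((\<lambda>x. 2 * (x * (arcsin (x / 2) / pi)) + 2 / pi * sqrt (4 - x\<^sup>2))
        has_real_derivative 2 * (arcsin (x / 2) / pi)) (at x)" .
    show "2 * (y * (arcsin (y / 2) / pi)) + 2 / pi * sqrt (4 - y\<^sup>2) = vkls_curve y"
      if "y \<in> {-2<..<2}" for y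
      using that by (subst V) (auto simp: algebra_simps)
  qed (use x in auto)
  show "continuous_on {-2..2} (\<lambda>x. 2 * (arcsin (x / 2) / pi))"
    by (intro continuous_intros) auto
  show "0 \<le> 2 * arcsine_density 0 2 x" if "x \<in> {-2<..<2}" for x
    using arcsine_density_nonneg[of x 0 2] that by simp
qed simp_all

lemma ptilde_vkls_curve:
  assumes "0 < k"
  shows "ptilde k vkls_curve = arcsine_moment 0 2 k"
proof -
  interpret arc_diagram vkls_curve "\<lambda>x. 2 * (arcsin (x / 2) / pi)" "\<lambda>x. 2 * arcsine_density 0 2 x"
     "-2" 2 0 by (rule arc_diagram_vkls_curve)
  have "((\<lambda>x. x ^ k * (2 * arcsine_density 0 2 x)) has_integral 2 * arcsine_moment 0 2 k) {-2..2}"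
    using has_integral_mult_right[OF has_integral_arcsine_moment[where c = 0 and r = 2 and n = k], of 2]
    by (simp add: algebra_simps)
  from has_integral_unique[OF has_integral_ptilde[OF assms] this] show ?thesis by simp
qed

theorem is_transition_measure_semicircle_law: "is_transition_measure semicircle_law vkls_curve"
  unfolding semicircle_law_def
proof (rule is_transition_measure_density[where m = "semicircle_moment 0 2"])
  show "((\<lambda>x. x ^ n * (1 / (2 * pi) * sqrt (4 - x\<^sup>2))) has_integral semicircle_moment 0 2 n) {-2..2}"
    for n
    using has_integral_semicircle_moment[where c = 0 and r = 2 and n = n] by simp
  show "0 \<le> 1 / (2 * pi) * sqrt (4 - x\<^sup>2)" if "x \<in> {-2..2}" for x :: real
    using square_dist_center_le[of x 0 2] that by simp
  show "semicircle_moment 0 2 0 = 1" by (rule semicircle_moment_0)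
  have "Abs_fps (\<lambda>k. if k = 0 then 0 else ptilde k vkls_curve / real k)
      = Abs_fps (\<lambda>k. if k = 0 then 0 else arcsine_moment 0 2 k / real k)"
    by (rule arg_cong[where f = Abs_fps]) (auto simp: ptilde_vkls_curve)
  then show "Abs_fps (semicircle_moment 0 2) = fps_compose (fps_exp 1)
      (Abs_fps (\<lambda>k. if k = 0 then 0 else ptilde k vkls_curve / real k))"
    using semicircle_moment_exp_formula by simp
qed measurable

section \<open>The Marchenko-Pastur curve and law\<close>

locale marchenko_pastur_parameter =
  fixes \<alpha> :: real
  assumes \<alpha>: "1 \<le> \<alpha>"
begin

definition "c = \<alpha> + 1"
definition "r = 2 * sqrt \<alpha>"
definition "\<beta> = \<alpha> - 1"

lemma r_pos: "0 < r" using \<alpha> by (simp add: r_def)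
lemma \<beta>_nonneg: "0 \<le> \<beta>" using \<alpha> by (simp add: \<beta>_def)
lemma mp_left_eq: "mp_left \<alpha> = c - r" by (simp add: mp_left_def c_def r_def)
lemma mp_right_eq: "mp_right \<alpha> = c + r" by (simp add: mp_right_def c_def r_def)
lemma r_square: "r\<^sup>2 = c\<^sup>2 - \<beta>\<^sup>2"
  using \<alpha> by (simp add: c_def r_def \<beta>_def power2_eq_square algebra_simps)

lemma endpoints_mult: "(c - r) * (c + r) = \<beta>\<^sup>2"
  using r_square by (simp add: power2_eq_square algebra_simps)

text \<open>
The product of the endpoints is \<open>\<beta>\<^sup>2\<close>, so the arc reaches the origin only for \<open>\<alpha> = 1\<close>, where the terms with
the factor \<open>\<beta> / x\<close> disappear as well.
\<close>

lemma left_cases: "(0 < c - r \<and> 0 < \<beta>) \<or> (c - r = 0 \<and> \<beta> = 0 \<and> c = 2 \<and> r = 2)"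
proof (cases "\<alpha> = 1")
  case True
  then show ?thesis unfolding c_def r_def \<beta>_def by simp
next
  case False
  then have b: "0 < \<beta>" using \<alpha> by (simp add: \<beta>_def)
  then have "0 < (c - r) * (c + r)" by (simp add: endpoints_mult)
  moreover have "0 < c + r" using r_pos \<alpha> by (simp add: c_def)
  ultimately show ?thesis using b zero_less_mult_pos2 by blast
qed

lemma center_between: "c - r \<le> \<alpha>" "\<alpha> \<le> c + r" "0 < c + r"
proof -
  have "1 \<le> sqrt \<alpha>" using \<alpha> by simp
  then show "c - r \<le> \<alpha>" "\<alpha> \<le> c + r" "0 < c + r"
    unfolding c_def r_def using \<alpha> by linarith+
qed

text \<open>
The substitution \<open>u = 1 / x\<close> shows that \<open>arcsin (c / r - \<beta>\<^sup>2 / (r x))\<close> is a primitive of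
\<open>\<beta> / (x \<surd>(r\<^sup>2 - (x - c)\<^sup>2))\<close>, because \<open>\<beta>\<^sup>2\<close> is the product of the endpoints. The argument is not put over
a common denominator: in this form it is constantly \<open>1\<close> for \<open>\<alpha> = 1\<close>, also at \<open>x = 0\<close>. The primitive then
contributes the constant \<open>1 / 2\<close>, which is the integration constant that the boundary values require.
\<close>

definition slope_arg :: "real \<Rightarrow> real" where
  "slope_arg x = c / r - \<beta>\<^sup>2 / (r * x)"

definition mp_slope :: "real \<Rightarrow> real" where
  "mp_slope x = (arcsin ((x - c) / r) + arcsin (slope_arg x)) / pi"

definition mp_curvature :: "real \<Rightarrow> real" where
  "mp_curvature x = (x + \<beta>) / x * arcsine_density c r x"

lemma slope_arg_critical:
  assumes "\<beta> = 0"
  shows "slope_arg x = 1"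
  using assms left_cases by (simp add: slope_arg_def)

lemma slope_arg_bounds:
  assumes x: "x \<in> {c - r..c + r}"
  shows "-1 \<le> slope_arg x" "slope_arg x \<le> 1"
proof -
  have "-1 \<le> slope_arg x \<and> slope_arg x \<le> 1"
  proof (cases "\<beta> = 0")
    case True
    then show ?thesis by (simp add: slope_arg_critical)
  next
    case False
    then have l: "0 < c - r" using left_cases by blast
    then have x0: "0 < x" using x by auto
    have e: "slope_arg x = (c - \<beta>\<^sup>2 / x) / r"
      by (simp add: slope_arg_def diff_divide_distrib mult.commute)
    have "(c - r) * x \<le> \<beta>\<^sup>2"
      unfolding endpoints_mult[symmetric] using x l by (intro mult_left_mono) auto
    moreover have "\<beta>\<^sup>2 \<le> x * (c + r)"
      unfolding endpoints_mult[symmetric] using x center_between by (intro mult_right_mono) auto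
    ultimately have "c - r \<le> \<beta>\<^sup>2 / x" "\<beta>\<^sup>2 / x \<le> c + r" using x0 by (auto simp: field_simps)
    then show ?thesis unfolding e using r_pos by (auto simp: field_simps)
  qed
  then show "-1 \<le> slope_arg x" "slope_arg x \<le> 1" by auto
qed

lemma mp_slope_right: "mp_slope (c + r) = 1"
proof -
  have "slope_arg (c + r) = 1"
  proof -
    have "\<beta>\<^sup>2 / (r * (c + r)) = (c - r) / r"
      unfolding endpoints_mult[symmetric] using center_between by simp
    then show ?thesis using r_pos by (simp add: slope_arg_def diff_divide_distrib)
  qed
  then show ?thesis using r_pos by (simp add: mp_slope_def)
qed

lemma mp_slope_left: "(0 < \<beta> \<and> mp_slope (c - r) = -1) \<or> (c - r = 0 \<and> \<beta> = 0 \<and> mp_slope (c - r) = 0)"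
proof (cases "\<beta> = 0")
  case True
  then show ?thesis using left_cases slope_arg_critical by (auto simp: mp_slope_def)
next
  case False
  then have l: "0 < c - r" "0 < \<beta>" using left_cases by auto
  have "\<beta>\<^sup>2 / (r * (c - r)) = (c + r) / r"
    unfolding endpoints_mult[symmetric] using l by simp
  then have "slope_arg (c - r) = -1"
    using r_pos by (simp add: slope_arg_def add_divide_distrib)
  then show ?thesis using r_pos l by (simp add: mp_slope_def)
qed

lemma continuous_on_mp_slope: "continuous_on {c - r..c + r} mp_slope"
proof -
  have "continuous_on {c - r..c + r} slope_arg"
  proof (cases "\<beta> = 0")
    case True
    then have "slope_arg = (\<lambda>x. 1)" using slope_arg_critical by blast
    then show ?thesis by simp
  next
    case False
    then show ?thesis unfolding slope_arg_def using left_cases r_pos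
      by (intro continuous_intros) auto
  qed
  then have "continuous_on {c - r..c + r} (\<lambda>x. arcsin (slope_arg x))"
    by (rule continuous_on_arcsin) (use slope_arg_bounds in auto)
  from continuous_on_add[OF continuous_on_arcsin_affine[OF r_pos, of c] this]
  show ?thesis unfolding mp_slope_def by (rule continuous_on_divide) auto
qed

text \<open>
With \<open>r\<^sup>2 = c\<^sup>2 - \<beta>\<^sup>2\<close> one finds \<open>1 - (slope_arg x)\<^sup>2 = \<beta>\<^sup>2 (r\<^sup>2 - (x - c)\<^sup>2) / (r x)\<^sup>2\<close>.
\<close>

lemma mp_slope_deriv:
  assumes x: "x \<in> {c - r<..<c + r}"
  shows "(mp_slope has_real_derivative mp_curvature x) (at x)"
proof -
  have x0: "0 < x" using x left_cases by auto
  have q: "0 < r\<^sup>2 - (x - c)\<^sup>2" using square_dist_center_less[OF x] by simp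
  have "((\<lambda>x. arcsin (slope_arg x) / pi) has_real_derivative \<beta> / x * arcsine_density c r x) (at x)"
  proof (cases "\<beta> = 0")
    case True
    then have "slope_arg = (\<lambda>x. 1)" using slope_arg_critical by blast
    then show ?thesis using True by simp
  next
    case False
    then have b: "0 < \<beta>" using \<beta>_nonneg by simp
    have "1 - (slope_arg x)\<^sup>2 = (r\<^sup>2 * x\<^sup>2 - (c * x - \<beta>\<^sup>2)\<^sup>2) / (r * x)\<^sup>2"
      unfolding slope_arg_def using r_pos x0 by (simp add: field_simps power2_eq_square)
    also have "r\<^sup>2 * x\<^sup>2 - (c * x - \<beta>\<^sup>2)\<^sup>2 = \<beta>\<^sup>2 * (r\<^sup>2 - (x - c)\<^sup>2)"
      unfolding r_square by (simp add: algebra_simps power2_eq_square)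
    finally have u: "1 - (slope_arg x)\<^sup>2 = \<beta>\<^sup>2 * (r\<^sup>2 - (x - c)\<^sup>2) / (r * x)\<^sup>2" .
    then have s: "sqrt (1 - (slope_arg x)\<^sup>2) = \<beta> * sqrt (r\<^sup>2 - (x - c)\<^sup>2) / (r * x)"
      using b r_pos x0 by (simp add: real_sqrt_divide real_sqrt_mult)
    have "0 < \<beta>\<^sup>2 * (r\<^sup>2 - (x - c)\<^sup>2) / (r * x)\<^sup>2" using b q r_pos x0 by simp
    then have "(slope_arg x)\<^sup>2 < 1" using u by linarith
    then have "\<bar>slope_arg x\<bar> < 1" by (simp add: abs_square_less_1)
    then have lt: "-1 < slope_arg x" "slope_arg x < 1" by auto
    have d: "(slope_arg has_real_derivative \<beta>\<^sup>2 / (r * x\<^sup>2)) (at x)"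
      unfolding slope_arg_def[abs_def] using r_pos x0
      by (auto intro!: derivative_eq_intros simp: field_simps power2_eq_square)
    have "((\<lambda>x. arcsin (slope_arg x) / pi) has_real_derivative
        inverse (sqrt (1 - (slope_arg x)\<^sup>2)) * (\<beta>\<^sup>2 / (r * x\<^sup>2)) / pi) (at x)"
      by (intro DERIV_cdivide DERIV_chain2[OF DERIV_arcsin d] lt)
    also have "inverse (sqrt (1 - (slope_arg x)\<^sup>2)) * (\<beta>\<^sup>2 / (r * x\<^sup>2)) / pi
        = \<beta> / x * arcsine_density c r x"
      unfolding s arcsine_density_def using q b r_pos x0
      by (simp add: field_simps power2_eq_square)
    finally show ?thesis .
  qed
  from DERIV_add[OF arcsin_has_arcsine_density[OF r_pos x] this]
  have "((\<lambda>x. arcsin ((x - c) / r) / pi + arcsin (slope_arg x) / pi) has_real_derivative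
     mp_curvature x) (at x)"
    using x0 by (simp add: mp_curvature_def add_divide_distrib ring_distribs)
  moreover have "(\<lambda>x. arcsin ((x - c) / r) / pi + arcsin (slope_arg x) / pi) = mp_slope"
    by (simp add: fun_eq_iff mp_slope_def add_divide_distrib)
  ultimately show ?thesis by simp
qed

lemma mp_curvature_nonneg: "x \<in> {c - r..c + r} \<Longrightarrow> 0 \<le> mp_curvature x"
  using arcsine_density_nonneg[of x c r] left_cases \<beta>_nonneg by (auto simp: mp_curvature_def)

lemma mp_curvature_eq:
  "mp_curvature x = (x + (\<alpha> - 1)) / (pi * x * sqrt (4 * \<alpha> - (x - (\<alpha> + 1))\<^sup>2))"
  using \<alpha> by (simp add: mp_curvature_def arcsine_density_def \<beta>_def c_def r_def power_mult_distrib
      mult_ac)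

lemma power_mp_curvature:
  assumes "0 < k" and x: "x \<in> {c - r..c + r}"
  shows "x ^ k * mp_curvature x
    = x ^ k * arcsine_density c r x + \<beta> * (x ^ (k - 1) * arcsine_density c r x)"
proof (cases "x = 0")
  case True
  then have "\<beta> = 0" using x left_cases by auto
  then show ?thesis using True assms by simp
next
  case False
  then show ?thesis using assms(1)
    by (cases k) (simp_all add: mp_curvature_def field_simps)
qed

lemma has_integral_power_mp_curvature:
  assumes "0 < k"
  shows "((\<lambda>x. x ^ k * mp_curvature x) has_integral
     arcsine_moment c r k + \<beta> * arcsine_moment c r (k - 1)) {c - r..c + r}"
proof -
  have "((\<lambda>x. x ^ k * arcsine_density c r x + \<beta> * (x ^ (k - 1) * arcsine_density c r x))
     has_integral arcsine_moment c r k + \<beta> * arcsine_moment c r (k - 1)) {c - r..c + r}"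
    by (intro has_integral_add has_integral_mult_right has_integral_arcsine_moment[OF r_pos])
  then show ?thesis
    by (rule has_integral_eq[rotated]) (use power_mp_curvature[OF assms] in simp)
qed

text \<open>
Integration by parts reduces the increment of the curve over the arc to the boundary values of the slope
and the arcsine moments \<open>1\<close> and \<open>c\<close>; this increment is what makes the two outer branches meet the arc.
\<close>

lemma integral_mp_slope: "integral {c - r..c + r} mp_slope = 2"
proof -
  have "((\<lambda>x. x * mp_curvature x + 1 * mp_slope x) has_integral
     (c + r) * mp_slope (c + r) - (c - r) * mp_slope (c - r)) {c - r..c + r}"
  proof (rule fundamental_theorem_of_calculus_interior)
    show "continuous_on {c - r..c + r} (\<lambda>x. x * mp_slope x)"
      by (intro continuous_intros continuous_on_mp_slope)
    show "((\<lambda>x. x * mp_slope x) has_vector_derivative x * mp_curvature x + 1 * mp_slope x) (at x)"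
      if "x \<in> {c - r<..<c + r}" for x
      unfolding has_real_derivative_iff_has_vector_derivative[symmetric]
      by (intro DERIV_mult' DERIV_ident mp_slope_deriv that)
  qed (use r_pos in simp)
  moreover have "(c + r) * mp_slope (c + r) - (c - r) * mp_slope (c - r) = 2 * c"
    using mp_slope_left by (auto simp: mp_slope_right)
  moreover have "((\<lambda>x. x * mp_curvature x) has_integral c + \<beta>) {c - r..c + r}"
    using has_integral_power_mp_curvature[of 1] arcsine_moment_1[OF r_pos] arcsine_moment_0[OF r_pos]
    by simp
  ultimately have "((\<lambda>x. (x * mp_curvature x + 1 * mp_slope x) - x * mp_curvature x) has_integral
     2 * c - (c + \<beta>)) {c - r..c + r}"
    by (intro has_integral_diff) (simp_all only:)
  then have "(mp_slope has_integral 2) {c - r..c + r}"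
    by (simp add: c_def \<beta>_def)
  then show ?thesis by (rule integral_unique)
qed

definition mp_curve :: "real \<Rightarrow> real" where
  "mp_curve x = (if x < c - r then \<alpha> - x
     else if x \<le> c + r then \<alpha> - (c - r) + integral {c - r..x} mp_slope else x - \<alpha>)"

sublocale arc_diagram mp_curve mp_slope mp_curvature "c - r" "c + r" \<alpha>
proof
  show "mp_curve x = \<alpha> - x" if "x \<le> c - r" for x
    using that r_pos by (cases "x = c - r") (auto simp: mp_curve_def)
  show "mp_curve x = x - \<alpha>" if "c + r \<le> x" for x
    using that r_pos integral_mp_slope
    by (cases "x = c + r") (auto simp: mp_curve_def c_def)
  have "continuous_on {c - r..c + r} (\<lambda>x. \<alpha> - (c - r) + integral {c - r..x} mp_slope)"
    by (intro continuous_intros indefinite_integral_continuous_1 integrable_continuous_real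
        continuous_on_mp_slope)
  then show "continuous_on {c - r..c + r} mp_curve"
    by (rule continuous_on_eq) (auto simp: mp_curve_def)
  show "(mp_curve has_real_derivative mp_slope x) (at x)" if x: "x \<in> {c - r<..<c + r}" for x
  proof (rule has_field_derivative_transform_within_open[where S = "{c - r<..<c + r}"])
    have "((\<lambda>x. integral {c - r..x} mp_slope) has_real_derivative mp_slope x)
        (at x within {c - r..c + r})"
      using integral_has_real_derivative[OF continuous_on_mp_slope] x by auto
    moreover have "at x within {c - r..c + r} = at x"
      using x by (intro at_within_interior) auto
    ultimately show "((\<lambda>x. \<alpha> - (c - r) + integral {c - r..x} mp_slope)
        has_real_derivative mp_slope x) (at x)"
      by (auto intro!: derivative_eq_intros)
  qed (use x in \<open>auto simp: mp_curve_def\<close>)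
  show "mp_slope (c - r) = -1 \<or> c - r = 0 \<and> -1 \<le> mp_slope (c - r)"
    using mp_slope_left by auto
  show "0 \<le> mp_curvature x" if "x \<in> {c - r<..<c + r}" for x
    using that by (intro mp_curvature_nonneg) auto
qed (use r_pos center_between mp_slope_deriv continuous_on_mp_slope mp_slope_right in auto)

lemma is_mp_curve_iff:
  "is_mp_curve \<alpha> v \<longleftrightarrow> continuous_on UNIV v \<and>
     (\<forall>x\<in>{c - r<..<c + r}. v differentiable (at x) \<and>
        (deriv v has_real_derivative mp_curvature x) (at x)) \<and>
     (\<forall>x\<in>{..c - r} \<union> {c + r..}. v x = \<bar>x - \<alpha>\<bar>)"
  unfolding is_mp_curve_def mp_left_eq mp_right_eq mp_curvature_eq ..

lemma is_mp_curve_mp_curve: "is_mp_curve \<alpha> mp_curve"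
  unfolding is_mp_curve_iff
proof (intro conjI ballI)
  have "1-lipschitz_on UNIV mp_curve"
    using w_lipschitz by (intro lipschitz_onI) (auto simp: dist_real_def)
  then show "continuous_on UNIV mp_curve" by (rule lipschitz_on_continuous_on)
  fix x assume x: "x \<in> {c - r<..<c + r}"
  show "mp_curve differentiable (at x)"
    using w_deriv[OF x] by (auto simp: real_differentiable_def)
  show "(deriv mp_curve has_real_derivative mp_curvature x) (at x)"
    by (rule has_field_derivative_transform_within_open[OF mp_slope_deriv[OF x],
          where S = "{c - r<..<c + r}"])
       (use x in \<open>auto simp: DERIV_imp_deriv[OF w_deriv]\<close>)
next
  fix x assume "x \<in> {..c - r} \<union> {c + r..}"
  then show "mp_curve x = \<bar>x - \<alpha>\<bar>"
    using w_left[of x] w_right[of x] center_between by auto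
qed

text \<open>
The slopes of two solutions differ by a constant \<open>k\<close> on the arc, so the solutions differ there by an affine
function; it vanishes at both ends and hence everywhere.
\<close>

lemma is_mp_curve_unique:
  assumes "is_mp_curve \<alpha> v"
  shows "v = mp_curve"
proof
  fix x
  define d where "d = (\<lambda>x. v x - mp_curve x)"
  define d' where "d' = (\<lambda>x. deriv v x - mp_slope x)"
  define k where "k = d' c"
  have d: "(d has_real_derivative d' x) (at x)" if "x \<in> {c - r<..<c + r}" for x
  proof -
    have "(v has_real_derivative deriv v x) (at x)"
      using assms that unfolding is_mp_curve_iff by (simp add: DERIV_deriv_iff_real_differentiable)
    then show ?thesis unfolding d_def d'_def by (intro DERIV_diff w_deriv that)
  qed
  have d'': "(d' has_real_derivative 0) (at x)" if "x \<in> {c - r<..<c + r}" for x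
  proof -
    have "(deriv v has_real_derivative mp_curvature x) (at x)"
      using assms that unfolding is_mp_curve_iff by blast
    from DERIV_diff[OF this mp_slope_deriv[OF that]] show ?thesis by (simp add: d'_def)
  qed
  have d'k: "d' x = k" if "x \<in> {c - r<..<c + r}" for x
    unfolding k_def using r_pos that d''
    by (intro DERIV_isconst3[of "c - r" "c + r"]) auto
  have d_cont: "continuous_on {c - r..c + r} d"
    unfolding d_def using assms w_cont unfolding is_mp_curve_iff
    by (intro continuous_on_diff) (auto intro: continuous_on_subset)
  have outside: "d x = 0" if "x \<le> c - r \<or> c + r \<le> x" for x
    using assms is_mp_curve_mp_curve that unfolding is_mp_curve_iff d_def by simp
  have const: "d x - k * x = d (c - r) - k * (c - r)" if "x \<in> {c - r..c + r}" for x
  proof (rule DERIV_isconst2[of "c - r" "c + r" "\<lambda>x. d x - k * x"])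
    show "continuous_on {c - r..c + r} (\<lambda>x. d x - k * x)"
      by (intro continuous_intros d_cont)
    show "((\<lambda>x. d x - k * x) has_real_derivative 0) (at y)" if "c - r < y" "y < c + r" for y
      using that d[of y] d'k[of y] by (auto intro!: derivative_eq_intros)
  qed (use that r_pos in auto)
  have "k = 0" using const[of "c + r"] outside[of "c - r"] outside[of "c + r"] r_pos
    by (simp add: algebra_simps)
  then have "d x = 0"
    using const[of x] outside[of x] outside[of "c - r"] by (cases "x \<in> {c - r..c + r}") auto
  then show "v x = mp_curve x" by (simp add: d_def)
qed

lemma ptilde_mp_curve:
  assumes "0 < k"
  shows "ptilde k mp_curve
     = (arcsine_moment c r k + (\<alpha> - 1) * arcsine_moment c r (k - 1)) / 2"
  using has_integral_unique[OF has_integral_ptilde[OF assms] has_integral_power_mp_curvature[OF assms]]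
  by (simp add: \<beta>_def)

text \<open>
Since \<open>r\<^sup>2 - (x - c)\<^sup>2 = 2 c x - x\<^sup>2 - \<beta>\<^sup>2\<close>, the density is half of \<open>2 c - x - \<beta>\<^sup>2 / x\<close> times the arcsine density.
The term with \<open>1 / x\<close> is integrated through \<open>mp_slope\<close>: it is \<open>\<beta>\<close> times the difference of the curvature
and the arcsine density.
\<close>

lemma marchenko_pastur_mass:
  "((\<lambda>x. sqrt (r\<^sup>2 - (x - c)\<^sup>2) / (2 * pi * x)) has_integral 1) {c - r..c + r}"
proof -
  let ?d = "arcsine_density c r"
  have "(mp_curvature has_integral mp_slope (c + r) - mp_slope (c - r)) {c - r..c + r}"
    using r_pos continuous_on_mp_slope mp_slope_deriv
    by (intro fundamental_theorem_of_calculus_interior)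
       (auto simp: has_real_derivative_iff_has_vector_derivative)
  from has_integral_diff[OF this arcsine_density_has_integral_1[OF r_pos]]
  have "((\<lambda>x. mp_curvature x - ?d x) has_integral - mp_slope (c - r)) {c - r..c + r}"
    by (simp add: mp_slope_right)
  from has_integral_mult_right[OF this, of \<beta>]
  have "((\<lambda>x. \<beta> * (mp_curvature x - ?d x)) has_integral \<beta>) {c - r..c + r}"
    using mp_slope_left by auto
  then have "((\<lambda>x. (2 * c * ?d x - x ^ 1 * ?d x - \<beta> * (mp_curvature x - ?d x)) / 2) has_integral
     (2 * c * 1 - arcsine_moment c r 1 - \<beta>) / 2) {c - r..c + r}"
    by (intro has_integral_divide has_integral_diff has_integral_mult_right
        has_integral_arcsine_moment r_pos arcsine_density_has_integral_1)
  moreover have "(2 * c * 1 - arcsine_moment c r 1 - \<beta>) / 2 = 1"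
    unfolding arcsine_moment_1[OF r_pos] by (simp add: c_def \<beta>_def)
  moreover have "(2 * c * ?d x - x ^ 1 * ?d x - \<beta> * (mp_curvature x - ?d x)) / 2
       = sqrt (r\<^sup>2 - (x - c)\<^sup>2) / (2 * pi * x)" if x: "x \<in> {c - r..c + r}" for x
  proof (cases "x = 0")
    case True
    then have "\<beta> = 0" "c = 2" "r = 2" using x left_cases by auto
    then show ?thesis using True by (simp add: arcsine_density_def)
  next
    case False
    have e: "r\<^sup>2 - (x - c)\<^sup>2 = 2 * c * x - x * x - \<beta> * \<beta>"
      unfolding r_square by (simp add: power2_eq_square algebra_simps)
    have "sqrt (r\<^sup>2 - (x - c)\<^sup>2) = pi * (2 * c * x - x * x - \<beta> * \<beta>) * ?d x"
      using sqrt_eq_arcsine_density[OF x] by (simp only: e)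
    then show ?thesis using False
      by (simp only:) (simp add: mp_curvature_def field_simps)
  qed
  ultimately show ?thesis by (rule_tac has_integral_eq) (assumption, simp only:)
qed

theorem is_transition_measure_marchenko_pastur:
  "is_transition_measure (marchenko_pastur \<alpha>) mp_curve"
proof -
  let ?f = "\<lambda>x. sqrt (r\<^sup>2 - (x - c)\<^sup>2) / (2 * pi * x)"
  let ?m = "\<lambda>k. if k = 0 then 1 else semicircle_moment c r (k - 1)"
  have "is_transition_measure (density lborel (\<lambda>x. ennreal (indicator {c - r..c + r} x * ?f x))) mp_curve"
  proof (rule is_transition_measure_density[where m = ?m])
    show "((\<lambda>x. x ^ n * ?f x) has_integral ?m n) {c - r..c + r}" for n
    proof (cases n)
      case 0
      then show ?thesis using marchenko_pastur_mass by simp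
    next
      case (Suc k)
      have "((\<lambda>x. x ^ Suc k * ?f x) has_integral semicircle_moment c r k) {c - r..c + r}"
      proof (rule has_integral_eq[OF _ has_integral_semicircle_moment])
        show "x ^ k * (sqrt (r\<^sup>2 - (x - c)\<^sup>2) / (2 * pi)) = x ^ Suc k * ?f x"
          if "x \<in> {c - r..c + r}" for x
        proof (cases "x = 0")
          case True
          then have "c = 2" "r = 2" using that left_cases by auto
          then show ?thesis using True by simp
        qed simp
      qed
      then show ?thesis using Suc by simp
    qed
    show "0 \<le> ?f x" if "x \<in> {c - r..c + r}" for x
      using square_dist_center_le[OF that] that left_cases by auto
    have "Abs_fps (\<lambda>k. if k = 0 then 0 else ptilde k mp_curve / real k)
      = Abs_fps (\<lambda>k. if k = 0 then 0 else
          ((arcsine_moment c r k + (\<alpha> - 1) * arcsine_moment c r (k - 1)) / 2) / real k)"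
      by (rule arg_cong[where f = Abs_fps]) (auto simp: ptilde_mp_curve)
    then show "Abs_fps ?m = fps_compose (fps_exp 1)
        (Abs_fps (\<lambda>k. if k = 0 then 0 else ptilde k mp_curve / real k))"
      using marchenko_pastur_exp_formula[of \<alpha>, folded c_def r_def] \<alpha> by simp
  qed auto
  then show ?thesis using \<alpha>
    unfolding marchenko_pastur_def mp_left_eq mp_right_eq
    by (simp add: c_def r_def power_mult_distrib)
qed

end

theorem proposition5p1:
  shows "(continual_young_diagram vkls_curve \<and>
            is_transition_measure semicircle_law vkls_curve) \<and>
         (\<forall>\<alpha>::real. \<alpha> \<ge> 1 \<longrightarrow>
            (\<exists>!w. is_mp_curve \<alpha> w) \<and>
            (\<forall>w. is_mp_curve \<alpha> w \<longrightarrow>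
               continual_young_diagram w \<and> is_transition_measure (marchenko_pastur \<alpha>) w))"
proof (intro conjI allI impI)
  show "continual_young_diagram vkls_curve"
    by (rule arc_diagram.continual_young_diagram[OF arc_diagram_vkls_curve])
  show "is_transition_measure semicircle_law vkls_curve"
    by (rule is_transition_measure_semicircle_law)
  fix \<alpha> :: real
  assume "1 \<le> \<alpha>"
  then interpret marchenko_pastur_parameter \<alpha> by unfold_locales
  show "\<exists>!w. is_mp_curve \<alpha> w"
    using is_mp_curve_mp_curve is_mp_curve_unique by blast
  fix w
  assume "is_mp_curve \<alpha> w"
  then have w: "w = mp_curve" by (rule is_mp_curve_unique)
  show "continual_young_diagram w" unfolding w by (rule continual_young_diagram)
  show "is_transition_measure (marchenko_pastur \<alpha>) w"
    unfolding w by (rule is_transition_measure_marchenko_pastur)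
qed

end
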